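(* Let $E$ be a Euclidean space and $T$ a (possibly set-valued, nonempty-valued) operator on $E$, with a chosen selection $x\mapsto x^+\in Tx$ and $x^{++}:=(x^+)^+\in Tx^+$. Then: (i) For every $x\in E$: if $x,x^+,x^{++}$ are not colinear then $L_Tx\in\operatorname{aff}\{x,x^+,x^{++}\}$; otherwise $L_Tx=x^+$. (ii) If $U\subset E$ is an affine subspace and $T(U)\subset U$, then $L_T(U)\subset U$.
   Context: $C(a,b,c)$ is the circumcenter of non-colinear points $a,b,c$: the unique point of $\operatorname{aff}\{a,b,c\}$ equidistant from $a,b,c$. $P_S$ is the orthogonal projection onto $S$. The maps $\pi_T$ and $L_T$ are $$\pi_Tx:=2(x^{++}-x^+)+2P_{\operatorname{span}(x^{++}-x^+)}(x^+-x)+x,$$ $$L_Tx:=\begin{cases}C(x,2x^+-x,\pi_Tx)&\text{if }x,2x^+-x,\pi_Tx\text{ are not colinear},\\ x^+&\text{otherwise}.\end{cases}$$ *)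

theory Defs
  imports "HOL-Analysis.Analysis"
begin

definition circumcenter :: "'a::euclidean_space \<Rightarrow> 'a \<Rightarrow> 'a \<Rightarrow> 'a" where
  "circumcenter a b c =
    (THE p. p \<in> affine hull {a, b, c} \<and> dist p a = dist p b \<and> dist p b = dist p c)"

definition selection_of :: "('a \<Rightarrow> 'a set) \<Rightarrow> ('a \<Rightarrow> 'a) \<Rightarrow> bool" where
  "selection_of T s \<longleftrightarrow> (\<forall>x. s x \<in> T x)"

(* Below, s is the chosen selection: s x is x^+ and s (s x) is x^{++}.
   The orthogonal projection onto a subspace is the library's nearest-point map closest_point. *)

definition pi_op :: "('a \<Rightarrow> 'a) \<Rightarrow> 'a \<Rightarrow> 'a::euclidean_space" where
  "pi_op s x =
    2 *\<^sub>R (s (s x) - s x) + 2 *\<^sub>R closest_point (span {s (s x) - s x}) (s x - x) + x"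

definition L_op :: "('a \<Rightarrow> 'a) \<Rightarrow> 'a \<Rightarrow> 'a::euclidean_space" where
  "L_op s x =
    (if \<not> collinear {x, 2 *\<^sub>R s x - x, pi_op s x}
     then circumcenter x (2 *\<^sub>R s x - x) (pi_op s x)
     else s x)"

end

(* The points 2 x^+ - x and pi_T x both lie in aff {x, x^+, x^{++}}, since the projection onto
   span (x^{++} - x^+) is a multiple of x^{++} - x^+; so the affine hull of the three points defining
   L_T x is contained in aff {x, x^+, x^{++}}, and the circumcenter, when it exists, lies there too. *)
theory Submission
  imports Defs
begin

text \<open>Equality in Cauchy-Schwarz would make \<open>0\<close>, \<open>B\<close>,
  \<open>C\<close> collinear. The difference of the two sides is the Gram determinant of
  \<open>B\<close> and \<open>C\<close>, which later serves as a denominator.\<close>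

lemma gram_pos_if_not_collinear:
  fixes B C :: "'a::euclidean_space"
  assumes "\<not> collinear {0, B, C}"
  shows "(B \<bullet> C)\<^sup>2 < (B \<bullet> B) * (C \<bullet> C)"
proof -
  have "\<bar>B \<bullet> C\<bar> \<noteq> norm B * norm C"
    using assms norm_cauchy_schwarz_equal by blast
  then have "\<bar>B \<bullet> C\<bar> < norm B * norm C"
    using Cauchy_Schwarz_ineq2[of B C] by linarith
  then have "\<bar>B \<bullet> C\<bar>\<^sup>2 < (norm B * norm C)\<^sup>2"
    by (intro power_strict_mono) auto
  then show ?thesis
    by (simp add: power_mult_distrib power2_norm_eq_inner)
qed

text \<open>Squaring both distances, the quadratic term in \<open>p\<close> cancels, so equidistance
  becomes a linear equation in \<open>p - a\<close>.\<close>

lemma dist_eq_iff_inner: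
  fixes a b p :: "'a::real_inner"
  shows "dist p a = dist p b \<longleftrightarrow> 2 * ((p - a) \<bullet> (b - a)) = (b - a) \<bullet> (b - a)"
proof -
  have "dist p a = dist p b \<longleftrightarrow> (p - a) \<bullet> (p - a) = (p - b) \<bullet> (p - b)"
    by (simp add: dist_norm norm_eq)
  also have "\<dots> \<longleftrightarrow> 2 * ((p - a) \<bullet> (b - a)) = (b - a) \<bullet> (b - a)"
    by (simp add: inner_diff_left inner_diff_right inner_commute) argo
  finally show ?thesis .
qed

lemma affine_hull_3_diff:
  "affine hull {a, b, c :: 'a::real_vector} = {a + \<beta> *\<^sub>R (b - a) + \<gamma> *\<^sub>R (c - a) | \<beta> \<gamma>. True}"
    (is "_ = ?R")
proof -
  have "affine hull {a, b, c} = {u *\<^sub>R a + v *\<^sub>R b + w *\<^sub>R c | u v w. u + v + w = 1}"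
    by (rule affine_hull_3)
  also have "\<dots> = ?R"
  proof (intro equalityI subsetI)
    fix p assume "p \<in> {u *\<^sub>R a + v *\<^sub>R b + w *\<^sub>R c | u v w. u + v + w = 1}"
    then obtain u v w where p: "p = u *\<^sub>R a + v *\<^sub>R b + w *\<^sub>R c" and "u + v + w = 1"
      by blast
    then have u: "u = 1 - v - w" by simp
    have "p = a + v *\<^sub>R (b - a) + w *\<^sub>R (c - a)"
      unfolding p u by (simp add: algebra_simps)
    then show "p \<in> ?R" by blast
  next
    fix p assume "p \<in> ?R"
    then obtain v w where "p = a + v *\<^sub>R (b - a) + w *\<^sub>R (c - a)"
      by blast
    then have "p = (1 - v - w) *\<^sub>R a + v *\<^sub>R b + w *\<^sub>R c"
      by (simp add: algebra_simps)
    moreover have "(1 - v - w) + v + w = 1" by simp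
    ultimately show "p \<in> {u *\<^sub>R a + v *\<^sub>R b + w *\<^sub>R c | u v w. u + v + w = 1}"
      by blast
  qed
  finally show ?thesis .
qed

text \<open>Makes the \<open>THE\<close> in \<open>circumcenter\<close> meaningful. With
  \<open>a\<close> as origin, equidistance is a linear system in the coordinates along
  \<open>B\<close> and \<open>C\<close>; its matrix is, up to a factor 2, their Gram matrix, with
  determinant \<open>D > 0\<close>.\<close>

lemma circumcenter_exists_unique:
  fixes a b c :: "'a::euclidean_space"
  assumes "\<not> collinear {a, b, c}"
  shows "\<exists>!p. p \<in> affine hull {a, b, c} \<and> dist p a = dist p b \<and> dist p b = dist p c"
proof -
  define B where "B = b - a"
  define C where "C = c - a"
  define D where "D = (B \<bullet> B) * (C \<bullet> C) - (B \<bullet> C)\<^sup>2"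
  have "\<not> collinear {0, B, C}"
    using assms collinear_3[of b a c] by (simp add: B_def C_def insert_commute)
  then have D: "D > 0"
    using gram_pos_if_not_collinear[of B C] by (simp add: D_def)
  \<comment> \<open>Both equations are based at \<open>a\<close>: the chain of equalities is traded
    for \<open>dist p a = dist p b\<close> and \<open>dist p a = dist p c\<close>.\<close>
  have eq: "dist p a = dist p b \<and> dist p b = dist p c \<longleftrightarrow>
      2 * ((p - a) \<bullet> B) = B \<bullet> B \<and> 2 * ((p - a) \<bullet> C) = C \<bullet> C" for p
    using dist_eq_iff_inner[of p a b] dist_eq_iff_inner[of p a c] by (auto simp: B_def C_def)
  have hull: "p \<in> affine hull {a, b, c} \<longleftrightarrow> (\<exists>\<beta> \<gamma>. p = a + \<beta> *\<^sub>R B + \<gamma> *\<^sub>R C)" for p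
    by (auto simp: affine_hull_3_diff B_def C_def)
  show ?thesis
  proof (rule ex_ex1I)
    (* Cramer's rule for the two linear equations in eq *)
    define \<beta> where "\<beta> = (C \<bullet> C) * (B \<bullet> B - B \<bullet> C) / (2 * D)"
    define \<gamma> where "\<gamma> = (B \<bullet> B) * (C \<bullet> C - B \<bullet> C) / (2 * D)"
    define p where "p = a + \<beta> *\<^sub>R B + \<gamma> *\<^sub>R C"
    have \<beta>: "2 * D * \<beta> = (C \<bullet> C) * (B \<bullet> B - B \<bullet> C)" and \<gamma>: "2 * D * \<gamma> = (B \<bullet> B) * (C \<bullet> C - B \<bullet> C)"
      using D by (simp_all add: \<beta>_def \<gamma>_def)
    \<comment> \<open>Scaling by \<open>D\<close> clears the denominators of \<beta> and \<gamma>;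
      the factor is cancelled afterwards since \<open>D > 0\<close>.\<close>
    have "D * (2 * ((p - a) \<bullet> B)) = (2 * D * \<beta>) * (B \<bullet> B) + (2 * D * \<gamma>) * (B \<bullet> C)"
      by (simp add: p_def inner_add_left inner_commute[of C B] distrib_left)
    also have "\<dots> = D * (B \<bullet> B)"
      unfolding \<beta> \<gamma> by (simp add: D_def power2_eq_square algebra_simps)
    finally have 1: "2 * ((p - a) \<bullet> B) = B \<bullet> B"
      using D by simp
    have "D * (2 * ((p - a) \<bullet> C)) = (2 * D * \<beta>) * (B \<bullet> C) + (2 * D * \<gamma>) * (C \<bullet> C)"
      by (simp add: p_def inner_add_left distrib_left)
    also have "\<dots> = D * (C \<bullet> C)"
      unfolding \<beta> \<gamma> by (simp add: D_def power2_eq_square algebra_simps)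
    finally have 2: "2 * ((p - a) \<bullet> C) = C \<bullet> C"
      using D by simp
    show "\<exists>p. p \<in> affine hull {a, b, c} \<and> dist p a = dist p b \<and> dist p b = dist p c"
      using 1 2 eq hull p_def by blast
  next
    fix p q
    assume "p \<in> affine hull {a, b, c} \<and> dist p a = dist p b \<and> dist p b = dist p c"
      and "q \<in> affine hull {a, b, c} \<and> dist q a = dist q b \<and> dist q b = dist q c"
    then obtain \<beta> \<gamma> \<beta>' \<gamma>' where p: "p = a + \<beta> *\<^sub>R B + \<gamma> *\<^sub>R C" and q: "q = a + \<beta>' *\<^sub>R B + \<gamma>' *\<^sub>R C"
      and e: "2 * ((p - a) \<bullet> B) = B \<bullet> B" "2 * ((p - a) \<bullet> C) = C \<bullet> C"
        "2 * ((q - a) \<bullet> B) = B \<bullet> B" "2 * ((q - a) \<bullet> C) = C \<bullet> C"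
      using eq hull by blast
    \<comment> \<open>Uniqueness: \<open>p - q\<close> is orthogonal to \<open>B\<close> and
      \<open>C\<close> but also a combination of them, hence orthogonal to itself.\<close>
    have orth: "(p - q) \<bullet> B = 0" "(p - q) \<bullet> C = 0"
      using e by (simp_all add: inner_diff_left)
    have "p - q = (\<beta> - \<beta>') *\<^sub>R B + (\<gamma> - \<gamma>') *\<^sub>R C"
      by (simp add: p q algebra_simps)
    then have "(p - q) \<bullet> (p - q) = (p - q) \<bullet> ((\<beta> - \<beta>') *\<^sub>R B + (\<gamma> - \<gamma>') *\<^sub>R C)"
      by simp
    also have "\<dots> = 0"
      using orth by (simp add: inner_add_right)
    finally show "p = q" by simp
  qed
qed

lemma circumcenter_in_affine_hull:
  assumes "\<not> collinear {a, b, c}"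
  shows "circumcenter a b c \<in> affine hull {a, b, c}"
  unfolding circumcenter_def using theI'[OF circumcenter_exists_unique[OF assms]] by (rule conjunct1)

lemma reflection_points_in_affine_hull:
  "{x, 2 *\<^sub>R s x - x, pi_op s x} \<subseteq> affine hull {x, s x, s (s x)}"
proof -
  \<comment> \<open>The nearest point belongs to the span because the span is closed and contains 0,
    even when it is just \<open>{0}\<close>.\<close>
  have "closest_point (span {s (s x) - s x}) (s x - x) \<in> span {s (s x) - s x}"
    using span_zero by (intro closest_point_in_set closed_span) blast
  then obtain t where t: "closest_point (span {s (s x) - s x}) (s x - x) = t *\<^sub>R (s (s x) - s x)"
    by (auto simp: span_singleton)
  \<comment> \<open>With \<open>v = s (s x) - s x\<close>, \<open>pi_op s x\<close> is
    \<open>x\<close> plus \<open>2 * (1 + t)\<close> times \<open>v\<close>; the coefficients come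
    from writing \<open>v\<close> as \<open>(s (s x) - x) - (s x - x)\<close>.\<close>
  have eqs: "2 *\<^sub>R s x - x = x + 2 *\<^sub>R (s x - x) + 0 *\<^sub>R (s (s x) - x)"
    "pi_op s x = x + (- 2 * (1 + t)) *\<^sub>R (s x - x) + (2 * (1 + t)) *\<^sub>R (s (s x) - x)"
    by (simp_all add: pi_op_def t algebra_simps scaleR_2)
  have "2 *\<^sub>R s x - x \<in> affine hull {x, s x, s (s x)}"
    "pi_op s x \<in> affine hull {x, s x, s (s x)}"
    unfolding affine_hull_3_diff using eqs by blast+
  then show ?thesis
    by (simp add: hull_inc)
qed

text \<open>Covers both branches of \<open>L_op\<close>, so that it yields the invariance of affine
  subspaces as well as the noncollinear case.\<close>

lemma L_op_in_affine_hull: "L_op s x \<in> affine hull {x, s x, s (s x)}"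
proof (cases "collinear {x, 2 *\<^sub>R s x - x, pi_op s x}")
  case True
  then show ?thesis by (simp add: L_op_def hull_inc)
next
  case False
  then have "L_op s x \<in> affine hull {x, 2 *\<^sub>R s x - x, pi_op s x}"
    by (simp add: L_op_def circumcenter_in_affine_hull)
  also have "\<dots> \<subseteq> affine hull {x, s x, s (s x)}"
    by (intro hull_minimal reflection_points_in_affine_hull affine_affine_hull)
  finally show ?thesis .
qed

text \<open>Collinearity passes to the affine hull and from there to the three points tested in
  \<open>L_op\<close>, which selects the default branch.\<close>

lemma L_op_eq_if_collinear:
  assumes "collinear {x, s x, s (s x)}"
  shows "L_op s x = s x"
proof -
  have "collinear (affine hull {x, s x, s (s x)})"
    using assms by (simp add: collinear_affine_hull_collinear)
  then have "collinear {x, 2 *\<^sub>R s x - x, pi_op s x}"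
    by (rule collinear_subset[OF _ reflection_points_in_affine_hull])
  then show ?thesis by (simp add: L_op_def)
qed

theorem proposition3:
  fixes T :: "'a::euclidean_space \<Rightarrow> 'a set" and s :: "'a \<Rightarrow> 'a"
  assumes "\<forall>x. T x \<noteq> {}"
    and "selection_of T s"
  shows "(\<forall>x. (\<not> collinear {x, s x, s (s x)} \<longrightarrow> L_op s x \<in> affine hull {x, s x, s (s x)}) \<and>
              (collinear {x, s x, s (s x)} \<longrightarrow> L_op s x = s x)) \<and>
         (\<forall>U. affine U \<and> (\<Union>x\<in>U. T x) \<subseteq> U \<longrightarrow> L_op s ` U \<subseteq> U)"
proof (intro conjI allI impI)
  fix x
  show "L_op s x \<in> affine hull {x, s x, s (s x)}"
    by (rule L_op_in_affine_hull)
  show "L_op s x = s x" if "collinear {x, s x, s (s x)}"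
    using that by (rule L_op_eq_if_collinear)
next
  fix U assume U: "affine U \<and> (\<Union>x\<in>U. T x) \<subseteq> U"
  show "L_op s ` U \<subseteq> U"
  proof
    fix y assume "y \<in> L_op s ` U"
    then obtain x where x: "x \<in> U" and y: "y = L_op s x" by blast
    have sU: "s z \<in> U" if "z \<in> U" for z
      using that U assms(2) by (auto simp: selection_of_def)
    \<comment> \<open>Applying \<open>sU\<close> twice puts all three points in \<open>U\<close>,
      and an affine set contains the affine hull of its points.\<close>
    have "affine hull {x, s x, s (s x)} \<subseteq> U"
      using x sU U by (intro hull_minimal) auto
    then show "y \<in> U"
      using L_op_in_affine_hull y by blast
  qed
qed

end
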